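(* Every second countable regularly preordered space $E$ admits a countable continuous utility representation, that is, there is a countable set $\{f_k : k\ge 1\}$ of continuous utility functions $f_k:E\to[0,1]$ such that for all $x,y\in E$ \[ x\le y \iff \forall k\ge 1,\ f_k(x)\le f_k(y). \]
   Context: A preorder is a reflexive and transitive relation; a topological preordered space $(E,\mathscr{T},\le)$ is a set $E$ with a topology $\mathscr{T}$ and a preorder $\le$. No separation axiom (neither Hausdorff nor $T_0$) is assumed on the topology. For $x\in E$, $i(x)=\{y: x\le y\}$ and $d(x)=\{y: y\le x\}$; for $S\subset E$, $i(S)=\bigcup_{x\in S} i(x)$, $d(S)=\bigcup_{x\in S} d(x)$. A set $S$ is increasing if $i(S)=S$ and decreasing if $d(S)=S$. The space is semiclosed preordered if $i(x)$ and $d(x)$ are closed for every $x\in E$. The space is regularly preordered if it is semiclosed preordered and: (i) whenever $B$ is a closed increasing set and $x\notin B$, there are an open decreasing set $U\ni x$ and an open increasing set $V\supset B$ with $U\cap V=\emptyset$; and (ii) dually, whenever $A$ is a closed decreasing set and $y\notin A$, there are an open increasing set $V\ni y$ and an open decreasing set $U\supset A$ with $U\cap V=\emptyset$. Write $x\sim y$ if $x\le y$ and $y\le x$, and $x<y$ if $x\le y$ and $y\not\le x$. A utility is a function $f:E\to\mathbb{R}$ such that $x\sim y\Rightarrow f(x)=f(y)$ and $x<y\Rightarrow f(x)<f(y)$. *)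

theory Defs
  imports "HOL-Analysis.Analysis"
begin

text \<open>
  A topological preordered space is given by a topology \<open>X\<close>, with \<open>E = topspace X\<close>, and a
  relation \<open>r\<close> on \<open>E\<close>, where \<open>(x, y) \<in> r\<close> means \<open>x \<le> y\<close>.
\<close>

definition top_preordered_space :: "'a topology \<Rightarrow> 'a rel \<Rightarrow> bool" where
  "top_preordered_space X r \<longleftrightarrow> preorder_on (topspace X) r"

definition inc_hull :: "'a rel \<Rightarrow> 'a set \<Rightarrow> 'a set" where
  "inc_hull r S = (\<Union>x\<in>S. {y. (x, y) \<in> r})"

definition dec_hull :: "'a rel \<Rightarrow> 'a set \<Rightarrow> 'a set" where
  "dec_hull r S = (\<Union>x\<in>S. {y. (y, x) \<in> r})"

text \<open>Since \<open>r \<subseteq> E \<times> E\<close>, increasing and decreasing sets are automatically subsets of \<open>E\<close>.\<close>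

definition increasing_set :: "'a rel \<Rightarrow> 'a set \<Rightarrow> bool" where
  "increasing_set r S \<longleftrightarrow> inc_hull r S = S"

definition decreasing_set :: "'a rel \<Rightarrow> 'a set \<Rightarrow> bool" where
  "decreasing_set r S \<longleftrightarrow> dec_hull r S = S"

definition semiclosed_preordered :: "'a topology \<Rightarrow> 'a rel \<Rightarrow> bool" where
  "semiclosed_preordered X r \<longleftrightarrow>
     top_preordered_space X r \<and>
     (\<forall>x\<in>topspace X. closedin X {y. (x, y) \<in> r} \<and> closedin X {y. (y, x) \<in> r})"

definition regularly_preordered :: "'a topology \<Rightarrow> 'a rel \<Rightarrow> bool" where
  "regularly_preordered X r \<longleftrightarrow>
     semiclosed_preordered X r \<and>
     (\<forall>B x. closedin X B \<and> increasing_set r B \<and> x \<in> topspace X \<and> x \<notin> B \<longrightarrow>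
        (\<exists>U V. openin X U \<and> decreasing_set r U \<and> x \<in> U \<and>
               openin X V \<and> increasing_set r V \<and> B \<subseteq> V \<and> U \<inter> V = {})) \<and>
     (\<forall>A y. closedin X A \<and> decreasing_set r A \<and> y \<in> topspace X \<and> y \<notin> A \<longrightarrow>
        (\<exists>U V. openin X V \<and> increasing_set r V \<and> y \<in> V \<and>
               openin X U \<and> decreasing_set r U \<and> A \<subseteq> U \<and> U \<inter> V = {}))"

definition utility_on :: "'a set \<Rightarrow> 'a rel \<Rightarrow> ('a \<Rightarrow> real) \<Rightarrow> bool" where
  "utility_on E r f \<longleftrightarrow>
     (\<forall>x\<in>E. \<forall>y\<in>E.
        ((x, y) \<in> r \<and> (y, x) \<in> r \<longrightarrow> f x = f y) \<and>
        ((x, y) \<in> r \<and> (y, x) \<notin> r \<longrightarrow> f x < f y))"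

end

theory Submission
  imports Defs
begin

text \<open>
  The proof combines an order-theoretic Urysohn lemma with two uses of the Lindelof property.

  The classical argument that a regular Lindelof space is normal only forms countable unions of
  differences of an open set and finitely many closed sets. If the open set is decreasing and the
  closed sets are increasing (or vice versa), these operations stay within the monotone sets, so a
  second countable regularly preordered space separates disjoint closed monotone sets of opposite
  kinds by open monotone sets (\<open>regularly_preordered_imp_normally_preordered\<close>). Urysohn's
  construction, carried out with decreasing sets, then yields isotone continuous functions
  (\<open>normally_preordered_Urysohn\<close>).

  If \<open>x \<le> y\<close> fails, then \<open>d(y)\<close> and \<open>i(x)\<close> are disjoint closed monotone sets, hence some isotone
  continuous \<open>f\<close> has \<open>f x > f y\<close>. The sets \<open>{(p, q). f p > f q}\<close> are therefore an open cover of
  the complement of the graph of the preorder in \<open>E \<times> E\<close>. Since \<open>E \<times> E\<close> is second countable,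
  countably many of these functions, \<open>g\<^sub>0, g\<^sub>1, \<dots>\<close>, represent the preorder
  (\<open>countable_isotone_representation\<close>).

  An isotone map need not be a utility, because it may be constant along \<open>x < y\<close>. The weighted sum
  \<open>u\<close> of the \<open>g\<^sub>n\<close> with weights \<open>1 / 2 ^ (n + 1)\<close> is one, since some \<open>g\<^sub>n\<close> separates \<open>y\<close> from \<open>x\<close>
  (\<open>isotone_map_utility_of_representation\<close>). Mixing a positive share of \<open>u\<close> into \<open>g\<^sub>n\<close> makes it a
  utility, and letting that share tend to \<open>0\<close> along \<open>1 / (m + 1)\<close> recovers the inequality for
  \<open>g\<^sub>n\<close> from those for the mixtures.
\<close>

section \<open>Monotone sets\<close>

lemma increasing_set_iff:
  assumes "preorder_on E r"
  shows "increasing_set r S \<longleftrightarrow> S \<subseteq> E \<and> (\<forall>x y. x \<in> S \<longrightarrow> (x, y) \<in> r \<longrightarrow> y \<in> S)"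
proof -
  have "r \<subseteq> E \<times> E" and "\<And>x. x \<in> E \<Longrightarrow> (x, x) \<in> r"
    using assms by (auto simp: preorder_on_def dest: refl_onD)
  then show ?thesis
    unfolding increasing_set_def inc_hull_def by blast
qed

lemma decreasing_set_iff:
  assumes "preorder_on E r"
  shows "decreasing_set r S \<longleftrightarrow> S \<subseteq> E \<and> (\<forall>x y. x \<in> S \<longrightarrow> (y, x) \<in> r \<longrightarrow> y \<in> S)"
proof -
  have "r \<subseteq> E \<times> E" and "\<And>x. x \<in> E \<Longrightarrow> (x, x) \<in> r"
    using assms by (auto simp: preorder_on_def dest: refl_onD)
  then show ?thesis
    unfolding decreasing_set_def dec_hull_def by blast
qed

lemma increasing_set_Diff:
  assumes "preorder_on E r" "decreasing_set r S"
  shows "increasing_set r (E - S)"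
  using assms by (auto simp: increasing_set_iff decreasing_set_iff preorder_on_def)

lemma decreasing_set_Diff:
  assumes "preorder_on E r" "increasing_set r S"
  shows "decreasing_set r (E - S)"
  using assms by (auto simp: increasing_set_iff decreasing_set_iff preorder_on_def)

section \<open>The Lindelof property of second countable spaces\<close>

text \<open>
  The cover is indexed, and the countable subcover comes as a sequence, so that each covering set can
  carry further data: a closed monotone superset in the proof of normality, a function in the
  representation of the preorder. For each basic open set lying in some covering set, one such index
  is chosen.
\<close>

lemma second_countable_countable_subcover:
  assumes "second_countable X" "I \<noteq> {}"
    and cover: "\<And>x. x \<in> S \<Longrightarrow> \<exists>i\<in>I. openin X (U i) \<and> x \<in> U i"
  obtains i :: "nat \<Rightarrow> 'i" where "range i \<subseteq> I" "S \<subseteq> (\<Union>n. U (i n))"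
proof -
  obtain \<B> where "countable \<B>"
    and base: "\<And>V x. openin X V \<Longrightarrow> x \<in> V \<Longrightarrow> \<exists>W\<in>\<B>. x \<in> W \<and> W \<subseteq> V"
    using assms(1) unfolding second_countable_def by metis
  define pick where "pick W = (SOME i. i \<in> I \<and> W \<subseteq> U i)" for W
  have pick: "pick W \<in> I \<and> W \<subseteq> U (pick W)" if "i \<in> I" "W \<subseteq> U i" for i W
    unfolding pick_def by (rule someI) (use that in blast)
  obtain i0 where "i0 \<in> I"
    using assms(2) by blast
  define J where "J = insert i0 (pick ` {W \<in> \<B>. \<exists>i\<in>I. W \<subseteq> U i})"
  have J: "countable J" "J \<noteq> {}" "J \<subseteq> I"
    using \<open>countable \<B>\<close> \<open>i0 \<in> I\<close> pick by (auto simp: J_def)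
  have "S \<subseteq> (\<Union>i\<in>J. U i)"
  proof
    fix x assume "x \<in> S"
    with cover obtain i where i: "i \<in> I" "openin X (U i)" "x \<in> U i"
      by blast
    with base obtain W where W: "W \<in> \<B>" "x \<in> W" "W \<subseteq> U i"
      by blast
    then have "pick W \<in> J" "x \<in> U (pick W)"
      using pick[OF i(1) W(3)] i(1) by (auto simp: J_def)
    then show "x \<in> (\<Union>i\<in>J. U i)"
      by blast
  qed
  moreover have "range (from_nat_into J) = J"
    using J by simp
  ultimately show ?thesis
    using J by (intro that[of "from_nat_into J"]) (simp, metis image_image)
qed

lemma second_countable_prod_topology:
  assumes "second_countable X" "second_countable Y"
  shows "second_countable (prod_topology X Y)"
proof -
  obtain \<A> where \<A>: "countable \<A>" "\<And>V. V \<in> \<A> \<Longrightarrow> openin X V"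
      "\<And>V x. openin X V \<Longrightarrow> x \<in> V \<Longrightarrow> \<exists>W\<in>\<A>. x \<in> W \<and> W \<subseteq> V"
    using assms(1) unfolding second_countable_def by metis
  obtain \<B> where \<B>: "countable \<B>" "\<And>V. V \<in> \<B> \<Longrightarrow> openin Y V"
      "\<And>V y. openin Y V \<Longrightarrow> y \<in> V \<Longrightarrow> \<exists>W\<in>\<B>. y \<in> W \<and> W \<subseteq> V"
    using assms(2) unfolding second_countable_def by metis
  show ?thesis
    unfolding second_countable_def
  proof (intro exI conjI ballI allI impI)
    show "countable ((\<lambda>(A, B). A \<times> B) ` (\<A> \<times> \<B>))"
      using \<A>(1) \<B>(1) by blast
    show "openin (prod_topology X Y) V" if "V \<in> (\<lambda>(A, B). A \<times> B) ` (\<A> \<times> \<B>)" for V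
      using that \<A>(2) \<B>(2) by (auto simp: openin_prod_Times_iff)
    show "\<exists>V\<in>(\<lambda>(A, B). A \<times> B) ` (\<A> \<times> \<B>). z \<in> V \<and> V \<subseteq> U"
      if U: "openin (prod_topology X Y) U \<and> z \<in> U" for U z
    proof -
      obtain V W where VW: "openin X V" "openin Y W" "fst z \<in> V" "snd z \<in> W" "V \<times> W \<subseteq> U"
        using U unfolding openin_prod_topology_alt by (metis prod.collapse)
      obtain A B where "A \<in> \<A>" "fst z \<in> A" "A \<subseteq> V" "B \<in> \<B>" "snd z \<in> B" "B \<subseteq> W"
        using \<A>(3) \<B>(3) VW by meson
      with VW show ?thesis
        by (intro bexI[of _ "A \<times> B"]) (auto simp: mem_Times_iff)
    qed
  qed
qed

section \<open>Normality\<close>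

definition normally_preordered :: "'a topology \<Rightarrow> 'a rel \<Rightarrow> bool" where
  "normally_preordered X r \<longleftrightarrow>
     semiclosed_preordered X r \<and>
     (\<forall>A B. closedin X A \<and> decreasing_set r A \<and> closedin X B \<and> increasing_set r B \<and> A \<inter> B = {} \<longrightarrow>
        (\<exists>U V. openin X U \<and> decreasing_set r U \<and> A \<subseteq> U \<and>
               openin X V \<and> increasing_set r V \<and> B \<subseteq> V \<and> U \<inter> V = {}))"

text \<open>
  Regularity covers \<open>A\<close> by open decreasing sets whose closed decreasing enlargements miss \<open>B\<close>, and
  symmetrically for \<open>B\<close>. With countable covers \<open>U n \<subseteq> C n\<close> and \<open>V n \<subseteq> D n\<close>, removing from each
  set the enlargements of the opposite kind up to the same index makes the two unions disjoint: for
  \<open>m \<le> n\<close> the set \<open>C m \<supseteq> U m\<close> has been removed from \<open>V n\<close>, and conversely.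
\<close>

lemma regularly_preordered_imp_normally_preordered:
  assumes sc: "second_countable X" and reg: "regularly_preordered X r"
  shows "normally_preordered X r"
  unfolding normally_preordered_def
proof (intro conjI allI impI)
  show "semiclosed_preordered X r"
    using reg by (simp add: regularly_preordered_def)
  then have pre: "preorder_on (topspace X) r"
    by (simp add: semiclosed_preordered_def top_preordered_space_def)
  fix A B
  assume "closedin X A \<and> decreasing_set r A \<and> closedin X B \<and> increasing_set r B \<and> A \<inter> B = {}"
  then have A: "closedin X A" "decreasing_set r A" and B: "closedin X B" "increasing_set r B"
    and AB: "A \<inter> B = {}"
    by auto
  have point_closed: "\<exists>U V. openin X U \<and> decreasing_set r U \<and> x \<in> U \<and>
      openin X V \<and> increasing_set r V \<and> B \<subseteq> V \<and> U \<inter> V = {}"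
    if "closedin X B" "increasing_set r B" "x \<in> topspace X" "x \<notin> B" for B x
    using reg that unfolding regularly_preordered_def by simp
  have closed_point: "\<exists>U V. openin X V \<and> increasing_set r V \<and> y \<in> V \<and>
      openin X U \<and> decreasing_set r U \<and> A \<subseteq> U \<and> U \<inter> V = {}"
    if "closedin X A" "decreasing_set r A" "y \<in> topspace X" "y \<notin> A" for A y
    using reg that unfolding regularly_preordered_def by simp
  have AX: "A \<subseteq> topspace X" and BX: "B \<subseteq> topspace X"
    using A B closedin_subset by auto

  \<comment> \<open>The second components replace the closures of the usual argument, which need not be decreasing.\<close>
  define I where "I = {(U, C). openin X U \<and> decreasing_set r U \<and>
                               closedin X C \<and> decreasing_set r C \<and> U \<subseteq> C \<and> C \<inter> B = {}}"
  have "({}, {}) \<in> I"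
    using pre by (simp add: I_def decreasing_set_iff)
  moreover have "\<exists>i\<in>I. openin X (fst i) \<and> x \<in> fst i" if "x \<in> A" for x
  proof -
    have "x \<in> topspace X" "x \<notin> B"
      using that AX AB by auto
    then obtain U V where "openin X U" "decreasing_set r U" "x \<in> U"
        "openin X V" "increasing_set r V" "B \<subseteq> V" "U \<inter> V = {}"
      using point_closed[OF B] by blast
    then show ?thesis
      by (intro bexI[of _ "(U, topspace X - V)"])
         (auto simp: I_def decreasing_set_Diff[OF pre] dest: openin_subset)
  qed
  ultimately obtain i :: "nat \<Rightarrow> _" where i: "range i \<subseteq> I" "A \<subseteq> (\<Union>n. fst (i n))"
    using second_countable_countable_subcover[OF sc, of I A fst] by blast
  define U C where "U n = fst (i n)" and "C n = snd (i n)" for n :: nat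
  have U: "openin X (U n)" "decreasing_set r (U n)" "U n \<subseteq> C n"
    and C: "closedin X (C n)" "decreasing_set r (C n)" "C n \<inter> B = {}" for n
    using i(1) by (auto simp: U_def C_def I_def image_subset_iff split_beta)

  define J where "J = {(V, D). openin X V \<and> increasing_set r V \<and>
                               closedin X D \<and> increasing_set r D \<and> V \<subseteq> D \<and> D \<inter> A = {}}"
  have "({}, {}) \<in> J"
    using pre by (simp add: J_def increasing_set_iff)
  moreover have "\<exists>j\<in>J. openin X (fst j) \<and> y \<in> fst j" if "y \<in> B" for y
  proof -
    have "y \<in> topspace X" "y \<notin> A"
      using that BX AB by auto
    then obtain U V where "openin X V" "increasing_set r V" "y \<in> V"
        "openin X U" "decreasing_set r U" "A \<subseteq> U" "U \<inter> V = {}"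
      using closed_point[OF A] by blast
    then show ?thesis
      by (intro bexI[of _ "(V, topspace X - U)"])
         (auto simp: J_def increasing_set_Diff[OF pre] dest: openin_subset)
  qed
  ultimately obtain j :: "nat \<Rightarrow> _" where j: "range j \<subseteq> J" "B \<subseteq> (\<Union>n. fst (j n))"
    using second_countable_countable_subcover[OF sc, of J B fst] by blast
  define V D where "V n = fst (j n)" and "D n = snd (j n)" for n :: nat
  have V: "openin X (V n)" "increasing_set r (V n)" "V n \<subseteq> D n"
    and D: "closedin X (D n)" "increasing_set r (D n)" "D n \<inter> A = {}" for n
    using j(1) by (auto simp: V_def D_def J_def image_subset_iff split_beta)

  define U' V' where "U' = (\<Union>n. U n - (\<Union>k\<le>n. D k))" and "V' = (\<Union>n. V n - (\<Union>k\<le>n. C k))"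
  show "\<exists>U V. openin X U \<and> decreasing_set r U \<and> A \<subseteq> U \<and>
              openin X V \<and> increasing_set r V \<and> B \<subseteq> V \<and> U \<inter> V = {}"
  proof (intro exI conjI)
    show "openin X U'" "openin X V'"
      unfolding U'_def V'_def using U V C D
      by (auto intro!: openin_diff closedin_Union)
    show "decreasing_set r U'"
      unfolding decreasing_set_iff[OF pre]
    proof (intro conjI allI impI)
      show "U' \<subseteq> topspace X"
        using \<open>openin X U'\<close> openin_subset by blast
      show "y \<in> U'" if x: "x \<in> U'" and xy: "(y, x) \<in> r" for x y
      proof -
        obtain n where n: "x \<in> U n" "\<And>k. k \<le> n \<Longrightarrow> x \<notin> D k"
          using x by (auto simp: U'_def)
        have "y \<in> U n"
          using U(2) n(1) xy by (metis decreasing_set_iff[OF pre])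
        moreover have "y \<notin> D k" if "k \<le> n" for k
          using D(2) n(2)[OF that] xy by (metis increasing_set_iff[OF pre])
        ultimately show ?thesis
          by (auto simp: U'_def)
      qed
    qed
    show "increasing_set r V'"
      unfolding increasing_set_iff[OF pre]
    proof (intro conjI allI impI)
      show "V' \<subseteq> topspace X"
        using \<open>openin X V'\<close> openin_subset by blast
      show "y \<in> V'" if x: "x \<in> V'" and xy: "(x, y) \<in> r" for x y
      proof -
        obtain n where n: "x \<in> V n" "\<And>k. k \<le> n \<Longrightarrow> x \<notin> C k"
          using x by (auto simp: V'_def)
        have "y \<in> V n"
          using V(2) n(1) xy by (metis increasing_set_iff[OF pre])
        moreover have "y \<notin> C k" if "k \<le> n" for k
          using C(2) n(2)[OF that] xy by (metis decreasing_set_iff[OF pre])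
        ultimately show ?thesis
          by (auto simp: V'_def)
      qed
    qed
    show "A \<subseteq> U'"
    proof
      fix x assume "x \<in> A"
      then have "x \<notin> D k" for k
        using D(3)[of k] by blast
      moreover obtain n where "x \<in> U n"
        using i(2) \<open>x \<in> A\<close> by (auto simp: U_def)
      ultimately show "x \<in> U'"
        by (auto simp: U'_def)
    qed
    show "B \<subseteq> V'"
    proof
      fix x assume "x \<in> B"
      then have "x \<notin> C k" for k
        using C(3)[of k] by blast
      moreover obtain n where "x \<in> V n"
        using j(2) \<open>x \<in> B\<close> by (auto simp: V_def)
      ultimately show "x \<in> V'"
        by (auto simp: V'_def)
    qed
    show "U' \<inter> V' = {}"
    proof (rule ccontr)
      assume "U' \<inter> V' \<noteq> {}"
      then obtain x where "x \<in> U'" "x \<in> V'"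
        by blast
      then obtain m n where x: "x \<in> U m" "\<forall>k\<le>m. x \<notin> D k" "x \<in> V n" "\<forall>k\<le>n. x \<notin> C k"
        unfolding U'_def V'_def by blast
      then show False
        using x U(3)[of m] V(3)[of n] by (cases "m \<le> n") auto
    qed
  qed
qed

section \<open>An order-preserving Urysohn lemma\<close>

definition isotone_maps :: "'a topology \<Rightarrow> 'a rel \<Rightarrow> ('a \<Rightarrow> real) set" where
  "isotone_maps X r = {f. continuous_map X (top_of_set {0..1}) f \<and> (\<forall>(x, y)\<in>r. f x \<le> f y)}"

lemma isotone_maps_range: "f \<in> isotone_maps X r \<Longrightarrow> x \<in> topspace X \<Longrightarrow> 0 \<le> f x \<and> f x \<le> 1"
  by (auto simp: isotone_maps_def continuous_map_in_subtopology)

lemma isotone_maps_mono: "f \<in> isotone_maps X r \<Longrightarrow> (x, y) \<in> r \<Longrightarrow> f x \<le> f y"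
  by (auto simp: isotone_maps_def)

lemma isotone_maps_continuous: "f \<in> isotone_maps X r \<Longrightarrow> continuous_map X euclideanreal f"
  by (auto simp: isotone_maps_def continuous_map_in_subtopology)

lemma dyadics_dense:
  fixes a b :: real
  assumes "0 \<le> a" "a < b"
  obtains d where "d \<in> dyadics" "a < d" "d < b"
proof -
  obtain n q p where "real q / 2^n \<le> a" "a < real p / 2^n" "\<bar>real q / 2^n - real p / 2^n\<bar> < b - a"
    by (rule padic_rational_approximation_straddle_pos_le[of "b - a" 2 a]) (use assms in auto)
  then show ?thesis
    by (intro that[of "real p / 2^n"]) (auto simp: dyadics_def)
qed

text \<open>
  Normality interpolates between \<open>U\<close> and \<open>V\<close> whenever a closed decreasing set lies between them; this
  relation \<open>R\<close> plays the part of ``the closure of \<open>U\<close> is contained in \<open>V\<close>''. A scale of open decreasing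
  sets \<open>G t\<close> indexed by the dyadic numbers in \<open>[0, 1]\<close> results, and \<open>f x\<close> is the infimum of the
  \<open>t\<close> with \<open>x \<in> G t\<close>. Isotonicity is immediate as every \<open>G t\<close> is decreasing.
\<close>

lemma normally_preordered_Urysohn:
  assumes norm: "normally_preordered X r"
    and A: "closedin X A" "decreasing_set r A"
    and B: "closedin X B" "increasing_set r B"
    and AB: "A \<inter> B = {}"
  obtains f where "f \<in> isotone_maps X r" "\<And>x. x \<in> A \<Longrightarrow> f x = 0" "\<And>x. x \<in> B \<Longrightarrow> f x = 1"
proof -
  have pre: "preorder_on (topspace X) r"
    using norm by (simp add: normally_preordered_def semiclosed_preordered_def top_preordered_space_def)
  have separated: "\<exists>U V. openin X U \<and> decreasing_set r U \<and> A \<subseteq> U \<and>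
      openin X V \<and> increasing_set r V \<and> B \<subseteq> V \<and> U \<inter> V = {}"
    if "closedin X A" "decreasing_set r A" "closedin X B" "increasing_set r B" "A \<inter> B = {}" for A B
    using norm that unfolding normally_preordered_def by simp
  define R where "R U V \<longleftrightarrow> openin X U \<and> decreasing_set r U \<and> openin X V \<and> decreasing_set r V \<and>
      (\<exists>C. closedin X C \<and> decreasing_set r C \<and> U \<subseteq> C \<and> C \<subseteq> V)" for U V
  have sep: "\<exists>U. openin X U \<and> decreasing_set r U \<and> C \<subseteq> U \<and>
      (\<exists>C'. closedin X C' \<and> decreasing_set r C' \<and> U \<subseteq> C' \<and> C' \<subseteq> V)"
    if C: "closedin X C" "decreasing_set r C" and V: "openin X V" "decreasing_set r V" and "C \<subseteq> V" for C V
  proof -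
    have "closedin X (topspace X - V)" "increasing_set r (topspace X - V)" "C \<inter> (topspace X - V) = {}"
      using V \<open>C \<subseteq> V\<close> increasing_set_Diff[OF pre] by auto
    then obtain U W where "openin X U" "decreasing_set r U" "C \<subseteq> U"
        "openin X W" "increasing_set r W" "topspace X - V \<subseteq> W" "U \<inter> W = {}"
      using separated[OF C, of "topspace X - V"] by blast
    then show ?thesis
      by (intro exI[of _ U] conjI exI[of _ "topspace X - W"])
         (auto simp: decreasing_set_Diff[OF pre] dest: openin_subset)
  qed
  have V1: "openin X (topspace X - B)" "decreasing_set r (topspace X - B)" "A \<subseteq> topspace X - B"
    using A B AB decreasing_set_Diff[OF pre] closedin_subset[OF A(1)] by auto
  obtain U0 where U0: "A \<subseteq> U0" "R U0 (topspace X - B)"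
    using sep[OF A V1] V1 unfolding R_def by blast
  have step: "\<exists>W. R U W \<and> R W V" if "R U V" for U V
    using that sep unfolding R_def by meson
  have Rtrans: "R U W" if "R U V" "R V W" for U V W
    using that unfolding R_def by (meson order_trans)
  define Q where "Q = dyadics \<inter> {0..1::real}"
  have "\<exists>G. G 0 = U0 \<and> G 1 = topspace X - B \<and> (\<forall>s\<in>Q. \<forall>t\<in>Q. s < t \<longrightarrow> R (G s) (G t))"
    unfolding Q_def
    by (rule recursion_on_dyadic_fractions[where R = R]) (blast intro: U0(2) step Rtrans)+
  then obtain G where G0: "G 0 = U0" and G1: "G 1 = topspace X - B"
    and G: "\<And>s t. s \<in> Q \<Longrightarrow> t \<in> Q \<Longrightarrow> s < t \<Longrightarrow> R (G s) (G t)"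
    by blast
  have Q01: "0 \<in> Q" "1 \<in> Q"
    using real_in_dyadics[of 0] real_in_dyadics[of 1] by (auto simp: Q_def)
  have opG: "openin X (G t)" and decG: "decreasing_set r (G t)" if "t \<in> Q" for t
  proof -
    have "R (G 0) (G t) \<or> R (G t) (G 1)"
      using G[of 0 t] G[of t 1] Q01 that by (cases "t = 0") (auto simp: Q_def)
    then show "openin X (G t)" "decreasing_set r (G t)"
      unfolding R_def by auto
  qed
  have monoG: "G s \<subseteq> G t" if "s \<in> Q" "t \<in> Q" "s \<le> t" for s t
    using G[of s t] that unfolding R_def by (cases "s = t") auto
  \<comment> \<open>Inserting \<open>1\<close> keeps the set nonempty on \<open>B\<close>, which no \<open>G t\<close> meets.\<close>
  define f where "f x = Inf (insert 1 {t \<in> Q. x \<in> G t})" for x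
  have bdd: "bdd_below (insert 1 {t \<in> Q. x \<in> G t})" for x
    by (rule bdd_belowI[of _ 0]) (auto simp: Q_def)
  have f_le1: "f x \<le> 1" for x
    unfolding f_def by (rule cInf_lower[OF _ bdd]) auto
  have f_le: "f x \<le> t" if "t \<in> Q" "x \<in> G t" for x t
    unfolding f_def by (rule cInf_lower[OF _ bdd]) (use that in auto)
  have f_ge: "s \<le> f x" if "s \<in> Q" "x \<notin> G s" for x s
    unfolding f_def
  proof (rule cInf_greatest)
    fix t assume "t \<in> insert 1 {t \<in> Q. x \<in> G t}"
    then show "s \<le> t"
      using monoG[of t s] that by (cases "s \<le> t") (auto simp: Q_def)
  qed auto
  have f_ge0: "0 \<le> f x" for x
    unfolding f_def by (rule cInf_greatest) (auto simp: Q_def)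
  have f_less: "f x < a \<longleftrightarrow> 1 < a \<or> (\<exists>t\<in>Q. t < a \<and> x \<in> G t)" for x a
    unfolding f_def by (subst cInf_less_iff[OF _ bdd]) auto
  have "openin X {x \<in> topspace X. f x < a}" for a
  proof (cases "1 < a")
    case False
    then have "{x \<in> topspace X. f x < a} = \<Union>(G ` {t\<in>Q. t < a})"
      using f_less openin_subset[OF opG] by auto
    then show ?thesis
      using opG by auto
  qed (use f_less in auto)
  moreover have "openin X {x \<in> topspace X. a < f x}" for a
  proof (cases "a < 0")
    case True
    then have "{x \<in> topspace X. a < f x} = topspace X"
      using f_ge0 by (auto intro: less_le_trans)
    then show ?thesis
      by simp
  next
    case False
    \<comment> \<open>The set \<open>G s\<close> itself is not closed; superlevel sets are open because between \<open>a\<close> and \<open>f x\<close>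
      there is room for two dyadic numbers \<open>s < t\<close> and a closed set between \<open>G s\<close> and \<open>G t\<close>.\<close>
    define \<C> where "\<C> = {C. closedin X C \<and> (\<exists>s\<in>Q. a < s \<and> G s \<subseteq> C)}"
    have "{x \<in> topspace X. a < f x} = (\<Union>C\<in>\<C>. topspace X - C)"
    proof (intro equalityI subsetI)
      fix x assume x: "x \<in> {x \<in> topspace X. a < f x}"
      obtain t where t: "t \<in> dyadics" "a < t" "t < f x"
        using dyadics_dense[of a "f x"] x False by auto
      obtain s where s: "s \<in> dyadics" "a < s" "s < t"
        using dyadics_dense[of a t] t False by auto
      have st: "s \<in> Q" "t \<in> Q"
        using s t False f_le1[of x] by (auto simp: Q_def)
      then obtain C where "closedin X C" "G s \<subseteq> C" "C \<subseteq> G t"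
        using G[OF _ _ \<open>s < t\<close>] unfolding R_def by blast
      moreover have "x \<notin> G t"
        using f_le[OF st(2)] t(3) by force
      ultimately show "x \<in> (\<Union>C\<in>\<C>. topspace X - C)"
        using x s(2) st(1) by (auto simp: \<C>_def)
    next
      fix x assume "x \<in> (\<Union>C\<in>\<C>. topspace X - C)"
      then obtain s where "s \<in> Q" "a < s" "x \<notin> G s" "x \<in> topspace X"
        by (auto simp: \<C>_def)
      then show "x \<in> {x \<in> topspace X. a < f x}"
        using f_ge[of s x] by auto
    qed
    also have "openin X \<dots>"
      by (rule openin_Union) (auto simp: \<C>_def)
    finally show ?thesis .
  qed
  ultimately have "continuous_map X (top_of_set {0..1}) f"
    unfolding continuous_map_upper_lower_semicontinuous_lt_gen using f_ge0 f_le1 by auto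
  moreover have "f x \<le> f y" if "(x, y) \<in> r" for x y
    unfolding f_def
    by (rule cInf_superset_mono[OF _ bdd])
       (use decG that in \<open>auto simp: decreasing_set_iff[OF pre]\<close>)
  ultimately have "f \<in> isotone_maps X r"
    by (auto simp: isotone_maps_def)
  moreover have "f x = 0" if "x \<in> A" for x
    using f_le[OF Q01(1), of x] f_ge0[of x] G0 U0(1) that by auto
  moreover have "f x = 1" if "x \<in> B" for x
    using f_ge[OF Q01(2), of x] f_le1[of x] G1 that by auto
  ultimately show ?thesis
    using that by blast
qed

section \<open>Countable families of isotone maps\<close>

text \<open>
  Second countability enters through \<open>X \<times> X\<close>: each isotone \<open>f\<close> gives the open set \<open>W f\<close> of pairs
  on which it refutes the preorder, and these sets cover the pairs outside \<open>r\<close>.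
\<close>

lemma countable_isotone_representation:
  assumes sc: "second_countable X" and norm: "normally_preordered X r"
  obtains g :: "nat \<Rightarrow> 'a \<Rightarrow> real" where "\<And>n. g n \<in> isotone_maps X r"
    and "\<And>x y. x \<in> topspace X \<Longrightarrow> y \<in> topspace X \<Longrightarrow> (x, y) \<in> r \<longleftrightarrow> (\<forall>n. g n x \<le> g n y)"
proof -
  have semi: "semiclosed_preordered X r"
    using norm by (simp add: normally_preordered_def)
  then have pre: "preorder_on (topspace X) r"
    by (simp add: semiclosed_preordered_def top_preordered_space_def)
  then have refl: "(x, x) \<in> r" if "x \<in> topspace X" for x
    using that by (auto simp: preorder_on_def dest: refl_onD)
  have tr: "(x, z) \<in> r" if "(x, y) \<in> r" "(y, z) \<in> r" for x y z
    using pre that by (auto simp: preorder_on_def dest: transD)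
  define W where "W f = {z \<in> topspace (prod_topology X X). f (fst z) - f (snd z) \<in> {0<..}}"
    for f :: "'a \<Rightarrow> real"
  have Wopen: "openin (prod_topology X X) (W f)" if "f \<in> isotone_maps X r" for f
    unfolding W_def
  proof (rule openin_continuous_map_preimage)
    show "continuous_map (prod_topology X X) euclideanreal (\<lambda>z. f (fst z) - f (snd z))"
      using isotone_maps_continuous[OF that]
      by (intro continuous_map_diff)
         (auto intro: continuous_map_compose[OF continuous_map_fst, unfolded o_def]
                      continuous_map_compose[OF continuous_map_snd, unfolded o_def])
  qed auto
  have Wcover: "\<exists>f\<in>isotone_maps X r. (x, y) \<in> W f"
    if "x \<in> topspace X" "y \<in> topspace X" "(x, y) \<notin> r" for x y
  proof -
    have "decreasing_set r {z. (z, y) \<in> r}" "increasing_set r {z. (x, z) \<in> r}"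
      unfolding decreasing_set_iff[OF pre] increasing_set_iff[OF pre]
      using pre tr by (auto simp: preorder_on_def)
    moreover have "{z. (z, y) \<in> r} \<inter> {z. (x, z) \<in> r} = {}"
      using tr that(3) by blast
    moreover have "closedin X {z. (z, y) \<in> r}" "closedin X {z. (x, z) \<in> r}"
      using semi that by (auto simp: semiclosed_preordered_def)
    ultimately obtain f where f: "f \<in> isotone_maps X r"
        "\<And>z. z \<in> {z. (z, y) \<in> r} \<Longrightarrow> f z = 0" "\<And>z. z \<in> {z. (x, z) \<in> r} \<Longrightarrow> f z = 1"
      using normally_preordered_Urysohn[OF norm, of "{z. (z, y) \<in> r}" "{z. (x, z) \<in> r}"] by blast
    then have "f y = 0" "f x = 1"
      using that refl by auto
    with f(1) show ?thesis
      using that by (intro bexI[of _ f]) (simp_all add: W_def)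
  qed
  have "(\<lambda>_. 0) \<in> isotone_maps X r"
    by (simp add: isotone_maps_def)
  then have "isotone_maps X r \<noteq> {}"
    by blast
  moreover have "\<exists>f\<in>isotone_maps X r. openin (prod_topology X X) (W f) \<and> z \<in> W f"
    if "z \<in> topspace X \<times> topspace X - r" for z
    using Wopen Wcover[of "fst z" "snd z"] that by auto
  ultimately obtain g :: "nat \<Rightarrow> _" where g: "range g \<subseteq> isotone_maps X r"
      "topspace X \<times> topspace X - r \<subseteq> (\<Union>n. W (g n))"
    using second_countable_countable_subcover[OF second_countable_prod_topology[OF sc sc],
        of "isotone_maps X r" "topspace X \<times> topspace X - r" W]
    by blast
  show ?thesis
  proof (rule that)
    show iso: "g n \<in> isotone_maps X r" for n
      using g(1) by blast
    show "(x, y) \<in> r \<longleftrightarrow> (\<forall>n. g n x \<le> g n y)" if "x \<in> topspace X" "y \<in> topspace X" for x y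
    proof
      show "\<forall>n. g n x \<le> g n y" if "(x, y) \<in> r"
        using isotone_maps_mono[OF iso that] by blast
      show "(x, y) \<in> r" if le: "\<forall>n. g n x \<le> g n y"
      proof (rule ccontr)
        assume "(x, y) \<notin> r"
        then obtain n where "(x, y) \<in> W (g n)"
          using g(2) \<open>x \<in> topspace X\<close> \<open>y \<in> topspace X\<close> by blast
        then show False
          using le[rule_format, of n] by (simp add: W_def)
      qed
    qed
  qed
qed

lemma continuous_map_suminf_halves:
  fixes g :: "nat \<Rightarrow> 'a \<Rightarrow> real"
  assumes cont: "\<And>n. continuous_map X euclideanreal (g n)"
    and bound: "\<And>n x. x \<in> topspace X \<Longrightarrow> \<bar>g n x\<bar> \<le> 1"
  shows "continuous_map X euclideanreal (\<lambda>x. \<Sum>n. (1/2) ^ Suc n * g n x)"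
proof -
  have "uniform_limit (topspace X) (\<lambda>n x. \<Sum>i<n. (1/2) ^ Suc i * g i x)
          (\<lambda>x. \<Sum>i. (1/2) ^ Suc i * g i x) sequentially"
  proof (rule Weierstrass_m_test)
    show "norm ((1/2) ^ Suc n * g n x) \<le> (1/2) ^ Suc n" if "x \<in> topspace X" for n x
      using bound[OF that, of n] by (simp add: abs_mult mult_left_le)
    show "summable (\<lambda>n. (1/2::real) ^ Suc n)"
      using power_half_series sums_summable by blast
  qed
  then have lim: "\<forall>\<^sub>F n in sequentially. \<forall>x\<in>topspace X.
      dist (\<Sum>i<n. (1/2) ^ Suc i * g i x) (\<Sum>i. (1/2) ^ Suc i * g i x) < e" if "e > 0" for e
    using that by (rule uniform_limitD)
  have "continuous_map X Met_TC.mtopology (\<lambda>x. \<Sum>n. (1/2) ^ Suc n * g n x)"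
  proof (rule Met_TC.continuous_map_uniform_limit)
    show "\<forall>\<^sub>F n in sequentially. continuous_map X Met_TC.mtopology (\<lambda>x. \<Sum>i<n. (1/2) ^ Suc i * g i x)"
      unfolding mtopology_is_euclidean
      by (intro always_eventually allI continuous_map_sum continuous_map_real_mult_left cont finite_lessThan)
  qed (use lim in auto)
  then show ?thesis
    by simp
qed

text \<open>
  The sum of the \<open>g n\<close> with weights \<open>1 / 2 ^ (n + 1)\<close> is strictly larger at \<open>y\<close> than at \<open>x\<close> when \<open>x < y\<close>: no
  term decreases, and one increases since the representation must detect that \<open>y \<le> x\<close> fails.
\<close>

lemma isotone_map_utility_of_representation:
  fixes g :: "nat \<Rightarrow> 'a \<Rightarrow> real"
  assumes pre: "preorder_on (topspace X) r"
    and iso: "\<And>n. g n \<in> isotone_maps X r"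
    and rep: "\<And>x y. x \<in> topspace X \<Longrightarrow> y \<in> topspace X \<Longrightarrow> (x, y) \<in> r \<longleftrightarrow> (\<forall>n. g n x \<le> g n y)"
  obtains u where "u \<in> isotone_maps X r" "utility_on (topspace X) r u"
proof -
  define u where "u x = (\<Sum>n. (1/2) ^ Suc n * g n x)" for x
  have rX: "x \<in> topspace X" "y \<in> topspace X" if "(x, y) \<in> r" for x y
    using pre that by (auto simp: preorder_on_def)
  have half: "summable (\<lambda>n. (1/2::real) ^ Suc n)"
    using power_half_series sums_summable by blast
  have summ: "summable (\<lambda>n. (1/2) ^ Suc n * g n x)" if "x \<in> topspace X" for x
    by (rule summable_comparison_test'[OF half, of 0])
       (use isotone_maps_range[OF iso that] in \<open>simp add: abs_mult mult_left_le\<close>)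
  have le: "u x \<le> u y" if "(x, y) \<in> r" for x y
    unfolding u_def
    using suminf_le[OF _ summ summ] rX[OF that] isotone_maps_mono[OF iso that] by simp
  have less: "u x < u y" if xy: "(x, y) \<in> r" "(y, x) \<notin> r" for x y
  proof -
    obtain n where n: "g n x < g n y"
      using rep[of y x] rX[OF xy(1)] xy(2) by (metis not_le)
    have "0 < (\<Sum>n. (1/2) ^ Suc n * g n y - (1/2) ^ Suc n * g n x)"
      by (rule suminf_pos2[where i = n])
         (use n summ rX[OF xy(1)] isotone_maps_mono[OF iso xy(1)] in \<open>auto intro: summable_diff\<close>)
    then show ?thesis
      unfolding u_def using suminf_diff[OF summ[OF rX(2)[OF xy(1)]] summ[OF rX(1)[OF xy(1)]]] by simp
  qed
  have "continuous_map X euclideanreal u"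
    unfolding u_def using isotone_maps_range[OF iso] isotone_maps_continuous[OF iso]
    by (intro continuous_map_suminf_halves) auto
  moreover have "0 \<le> u x \<and> u x \<le> 1" if "x \<in> topspace X" for x
  proof
    show "0 \<le> u x"
      unfolding u_def using isotone_maps_range[OF iso that] by (intro suminf_nonneg summ that) auto
    have "u x \<le> (\<Sum>n. (1/2) ^ Suc n)"
      unfolding u_def using isotone_maps_range[OF iso that]
      by (intro suminf_le summ half that) (auto simp: mult_left_le)
    then show "u x \<le> 1"
      using power_half_series by (simp add: sums_iff)
  qed
  ultimately have "u \<in> isotone_maps X r"
    using le by (auto simp: isotone_maps_def continuous_map_in_subtopology)
  moreover have "utility_on (topspace X) r u"
    using le less by (auto simp: utility_on_def intro: antisym)
  ultimately show ?thesis
    using that by blast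
qed

lemma utility_convex_combination:
  assumes g: "g \<in> isotone_maps X r" and u: "u \<in> isotone_maps X r" "utility_on (topspace X) r u"
    and c: "0 < c" "c \<le> 1"
  shows "continuous_map X (top_of_set {0..1}) (\<lambda>x. (1 - c) * g x + c * u x)"
    and "utility_on (topspace X) r (\<lambda>x. (1 - c) * g x + c * u x)"
proof -
  have "(1 - c) * g x + c * u x \<in> {0..1}" if "x \<in> topspace X" for x
    using convexD_alt[of "{0..1::real}" "g x" "u x" c] c
      isotone_maps_range[OF g that] isotone_maps_range[OF u(1) that] by simp
  then show "continuous_map X (top_of_set {0..1}) (\<lambda>x. (1 - c) * g x + c * u x)"
    unfolding continuous_map_in_subtopology
    using isotone_maps_continuous[OF g] isotone_maps_continuous[OF u(1)]
    by (auto intro!: continuous_map_add continuous_map_real_mult_left)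
  show "utility_on (topspace X) r (\<lambda>x. (1 - c) * g x + c * u x)"
    unfolding utility_on_def
  proof (intro ballI conjI impI)
    fix x y assume X: "x \<in> topspace X" "y \<in> topspace X"
    show "(1 - c) * g x + c * u x = (1 - c) * g y + c * u y" if "(x, y) \<in> r \<and> (y, x) \<in> r"
    proof -
      have "g x = g y" "u x = u y"
        using that isotone_maps_mono[OF g] isotone_maps_mono[OF u(1)] by (auto intro: antisym)
      then show ?thesis
        by simp
    qed
    show "(1 - c) * g x + c * u x < (1 - c) * g y + c * u y" if "(x, y) \<in> r \<and> (y, x) \<notin> r"
    proof -
      have "g x \<le> g y" "u x < u y"
        using that X u(2) isotone_maps_mono[OF g] by (auto simp: utility_on_def)
      then show ?thesis
        using c by (intro add_le_less_mono mult_left_mono mult_strict_left_mono) auto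
    qed
  qed
qed

section \<open>Countable continuous utility representation\<close>

theorem theorem5p5:
  fixes X :: "'a topology" and r :: "'a rel"
  assumes "second_countable X"
    and "regularly_preordered X r"
  shows "\<exists>f :: nat \<Rightarrow> 'a \<Rightarrow> real.
           (\<forall>k\<ge>1. continuous_map X (top_of_set {0..1}) (f k) \<and> utility_on (topspace X) r (f k)) \<and>
           (\<forall>x\<in>topspace X. \<forall>y\<in>topspace X. (x, y) \<in> r \<longleftrightarrow> (\<forall>k\<ge>1. f k x \<le> f k y))"
proof -
  have pre: "preorder_on (topspace X) r"
    using assms(2)
    by (simp add: regularly_preordered_def semiclosed_preordered_def top_preordered_space_def)
  obtain g :: "nat \<Rightarrow> 'a \<Rightarrow> real" where g: "\<And>n. g n \<in> isotone_maps X r"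
    and rep: "\<And>x y. x \<in> topspace X \<Longrightarrow> y \<in> topspace X \<Longrightarrow> (x, y) \<in> r \<longleftrightarrow> (\<forall>n. g n x \<le> g n y)"
    using countable_isotone_representation[OF assms(1)
        regularly_preordered_imp_normally_preordered[OF assms]] by blast
  obtain u where u: "u \<in> isotone_maps X r" "utility_on (topspace X) r u"
    using isotone_map_utility_of_representation[OF pre g rep] by blast
  define c where "c m = inverse (real (Suc m))" for m
  define h where "h p x = (1 - c (snd p)) * g (fst p) x + c (snd p) * u x" for p x
  have c: "0 < c m" "c m \<le> 1" for m
    by (auto simp: c_def field_simps)
  have lim: "(\<lambda>m. h (n, m) x) \<longlonglongrightarrow> g n x" for n x
  proof -
    have "c \<longlonglongrightarrow> 0"
      unfolding c_def by (rule LIMSEQ_inverse_real_of_nat)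
    then have "(\<lambda>m. (1 - c m) * g n x + c m * u x) \<longlonglongrightarrow> (1 - 0) * g n x + 0 * u x"
      by (intro tendsto_intros)
    then show ?thesis
      by (simp add: h_def)
  qed
  \<comment> \<open>The shift by one makes the indices \<open>k \<ge> 1\<close> run through all pairs \<open>(n, m)\<close>.\<close>
  define f where "f k = h (prod_decode (k - 1))" for k
  show ?thesis
  proof (intro exI[of _ f] conjI allI impI ballI)
    show "continuous_map X (top_of_set {0..1}) (f k)" "utility_on (topspace X) r (f k)" for k
      unfolding f_def h_def using utility_convex_combination[OF g u c] by auto
    show "(x, y) \<in> r \<longleftrightarrow> (\<forall>k\<ge>1. f k x \<le> f k y)" if X: "x \<in> topspace X" "y \<in> topspace X" for x y
    proof (intro iffI allI impI)
      fix k assume xy: "(x, y) \<in> r"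
      show "f k x \<le> f k y"
        unfolding f_def h_def using c
        by (intro add_mono mult_left_mono isotone_maps_mono[OF g xy] isotone_maps_mono[OF u(1) xy])
           (auto intro: less_imp_le)
    next
      assume le: "\<forall>k\<ge>1. f k x \<le> f k y"
      have "h p x \<le> h p y" for p
        using le[rule_format, of "Suc (prod_encode p)"] by (simp add: f_def)
      then have "g n x \<le> g n y" for n
        by (intro LIMSEQ_le[OF lim lim]) blast
      then show "(x, y) \<in> r"
        using rep X by blast
    qed
  qed
qed

end
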